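(* Let $\kappa$ be an infinite cardinal. Assume that $\binom{\kappa}{\kappa}\rightarrow\binom{\kappa}{\omega}_2$ holds and that $f:\kappa\rightarrow\mathcal{P}(\kappa)$ is $\kappa$-reasonable. Then there exists an infinite free subset for $f$.
   Context: $\binom{\kappa}{\kappa}\rightarrow\binom{\kappa}{\omega}_2$ means: for every coloring $c:\kappa\times\kappa\rightarrow 2$ there are $A,B\subseteq\kappa$ with $|A|=\kappa$ and $|B|=\aleph_0$ such that $c\upharpoonright(A\times B)$ is constant. For a function $f:\kappa\rightarrow\mathcal{P}(\kappa)$ and cardinals $\lambda,\mu$, $f$ is $C(\lambda,\mu)$ iff $|\bigcap\{f(x):x\in T\}|<\mu$ for every $T\subseteq\kappa$ with $|T|=\lambda$; $f$ is $\kappa$-reasonable iff $f$ is both $C(\kappa,\omega)$ and $C(\omega,\kappa)$. A set $A\subseteq\kappa$ is free for $f$ iff $x\notin f(y)$ whenever $\{x,y\}\subseteq A$ (with $x\neq y$). *)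

theory Defs
  imports Main "HOL-Library.FuncSet"
begin

unbundle cardinal_syntax

text \<open>
  Cardinals are the cardinal orders of the library: \<open>\<kappa>\<close> is a well-order relation with
  \<open>Card_order \<kappa>\<close>, the set underlying \<open>\<kappa>\<close> is \<open>Field \<kappa>\<close>, and \<open>natLeq\<close> is \<open>\<omega>\<close>.
  The carrier \<open>Field \<kappa>\<close> need not be the whole type.
\<close>

text \<open>The polarized partition relation with source \<open>(\<kappa>,\<kappa>)\<close>, target \<open>(\<kappa>,\<omega>)\<close> and two colours.\<close>

definition polarized :: "'a rel \<Rightarrow> bool" where
  "polarized \<kappa> \<longleftrightarrow>
    (\<forall>c \<in> Field \<kappa> \<times> Field \<kappa> \<rightarrow> {..<2::nat}.
      \<exists>A B. A \<subseteq> Field \<kappa> \<and> B \<subseteq> Field \<kappa> \<and> |A| =o \<kappa> \<and> |B| =o natLeq \<and>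
        (\<exists>i. \<forall>p \<in> A \<times> B. c p = i))"

text \<open>
  The property \<open>C(\<theta>,\<mu>)\<close> of \<open>f : \<kappa> \<rightarrow> P(\<kappa>)\<close>; \<open>\<theta>\<close> and \<open>\<mu>\<close> are cardinals that may live on
  other types. It is meant for \<open>\<theta> \<noteq> 0\<close>, as the intersection over an empty \<open>T\<close> would be \<open>UNIV\<close>.
\<close>

definition is_C :: "'a rel \<Rightarrow> 'b rel \<Rightarrow> 'c rel \<Rightarrow> ('a \<Rightarrow> 'a set) \<Rightarrow> bool" where
  "is_C \<kappa> \<theta> \<mu> f \<longleftrightarrow> (\<forall>T. T \<subseteq> Field \<kappa> \<and> |T| =o \<theta> \<longrightarrow> |\<Inter>x\<in>T. f x| <o \<mu>)"

definition reasonable :: "'a rel \<Rightarrow> ('a \<Rightarrow> 'a set) \<Rightarrow> bool" where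
  "reasonable \<kappa> f \<longleftrightarrow> is_C \<kappa> \<kappa> natLeq f \<and> is_C \<kappa> natLeq \<kappa> f"

definition free_for :: "'a rel \<Rightarrow> ('a \<Rightarrow> 'a set) \<Rightarrow> 'a set \<Rightarrow> bool" where
  "free_for \<kappa> f A \<longleftrightarrow> A \<subseteq> Field \<kappa> \<and> (\<forall>x\<in>A. \<forall>y\<in>A. x \<noteq> y \<longrightarrow> x \<notin> f y)"

end

(* Let D x y say that neither of x, y lies in the f-image of the other. If every set A of size k has
   a vertex with k many D-neighbours in A, iterating yields an infinite D-clique, which is free.
   Otherwise some S of size k has all D-degrees below k. The polarized relation and C(k,omega) give
   full A and infinite B with y \<notin> f x on A x B; outside D this means x \<in> f y, so it contradicts
   C(omega,k) once D misses a full part of A times an infinite part of B. This is the case if the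
   neighbourhoods of the points of B do not cover k many points of S. If they do, they exhibit a
   set of size k as a countable union of smaller sets, which can be thinned to a set of size k
   whose countably many levels are small and such that D holds only within levels. Apply the
   polarized relation there and separate A from B by levels. *)
theory Submission
  imports Defs "HOL-Library.Infinite_Set"
begin

section \<open>Sizes relative to an infinite cardinal\<close>

lemma subset_small_or_full:
  assumes "A \<subseteq> K" and "\<not> |A| =o |K|"
  shows "|A| <o |K|"
  using assms card_of_mono1 ordLeq_iff_ordLess_or_ordIso by blast

lemma finite_card_less_infinite:
  assumes "finite A" and "infinite K"
  shows "|A| <o |K|"
  using assms finite_ordLess_infinite[OF card_of_Well_order card_of_Well_order]
  by (simp add: Field_card_of)

lemma card_of_Diff_full:
  assumes "infinite K" and "A \<subseteq> K" and "|A| =o |K|" and "|B| <o |K|"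
  shows "|A - B| =o |K|"
proof (rule ccontr)
  assume "\<not> |A - B| =o |K|"
  then have "|A - B| <o |K|" using assms(2) by (intro subset_small_or_full) auto
  then have "|(A - B) \<union> B| <o |K|" using assms card_of_Un_ordLess_infinite by blast
  moreover have "|A| \<le>o |(A - B) \<union> B|" by (rule card_of_mono1) auto
  ultimately show False
    using assms(3) by (meson not_ordLess_ordIso ordLeq_ordLess_trans)
qed

lemma card_of_Un_full:
  assumes "infinite K" and "A \<subseteq> K" and "|A| =o |K|" and "A = A1 \<union> A2"
  shows "|A1| =o |K| \<or> |A2| =o |K|"
proof (rule ccontr)
  assume "\<not> ?thesis"
  moreover have "A1 \<subseteq> K" "A2 \<subseteq> K" using assms by auto
  ultimately have "|A1| <o |K|" "|A2| <o |K|" by (simp_all add: subset_small_or_full)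
  then have "|A| <o |K|" using assms(1,4) by (simp add: card_of_Un_ordLess_infinite)
  then show False using assms(3) not_ordLess_ordIso by blast
qed

lemma infinite_subset_natLeq:
  assumes "|B| =o natLeq" and "B' \<subseteq> B" and "infinite B'"
  shows "|B'| =o natLeq"
  by (meson assms card_of_mono1 infinite_iff_natLeq_ordLeq ordIso_iff_ordLeq
      ordLeq_ordIso_trans)

text \<open>If no \<open>E n\<close> exceeded \<open>X\<close> in size, an infinite \<open>X\<close>
  would bound the countable union as well, while for a finite \<open>X\<close> monotonicity would
  collect \<open>card X + 1\<close> points of the union in a single \<open>E n\<close>.\<close>

lemma chain_card_unbounded:
  fixes E :: "nat \<Rightarrow> 'a set"
  assumes "mono E" and "infinite (\<Union>n. E n)" and "|X| <o |\<Union>n. E n|"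
  shows "\<exists>n. |X| <o |E n|"
proof (rule ccontr)
  assume "\<not> ?thesis"
  then have le: "|E n| \<le>o |X|" for n by (meson card_of_Well_order not_ordLess_iff_ordLeq)
  show False
  proof (cases "finite X")
    case True
    obtain T where T: "T \<subseteq> (\<Union>n. E n)" "finite T" "card T = Suc (card X)"
      using assms(2) infinite_arbitrarily_large by blast
    then obtain g where g: "\<And>x. x \<in> T \<Longrightarrow> x \<in> E (g x)" by (metis UN_E subsetD)
    obtain n where "\<forall>k\<in>g ` T. k \<le> n"
      using T(2) by (meson finite_imageI finite_nat_set_iff_bounded_le)
    then have "T \<subseteq> E n" using g assms(1) unfolding mono_def by blast
    then have "|T| \<le>o |X|" using le card_of_mono1 ordLeq_transitive by blast
    then show False using T True
      by (metis Suc_n_not_le_n card_of_ordLeq card_inj_on_le)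
  next
    case False
    then have "|UNIV :: nat set| \<le>o |X|" using infinite_iff_card_of_nat by blast
    then have "|\<Union>n. E n| \<le>o |X|" using card_of_UNION_ordLeq_infinite[OF False] le by blast
    then show False using assms(3) not_ordLess_ordLeq by blast
  qed
qed

section \<open>The polarized relation on a set of full size\<close>

lemma polarized_subset:
  fixes \<kappa> :: "'a rel"
  assumes "polarized \<kappa>" and "|S| =o \<kappa>" and "Card_order \<kappa>"
  obtains A B where "A \<subseteq> S" "B \<subseteq> S" "|A| =o \<kappa>" "|B| =o natLeq"
    "(\<forall>x\<in>A. \<forall>y\<in>B. Q x y) \<or> (\<forall>x\<in>A. \<forall>y\<in>B. \<not> Q x y)"
proof -
  have "|Field \<kappa>| =o |S|"
    using assms by (meson card_of_Field_ordIso ordIso_symmetric ordIso_transitive)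
  then obtain h where h: "bij_betw h (Field \<kappa>) S" using card_of_ordIso by blast
  \<comment> \<open>The relation \<open>Q\<close> on \<open>S\<close> is pulled back along the
    bijection \<open>h\<close> to a colouring on the carrier; colour 0 means that \<open>Q\<close>
    holds.\<close>
  define c where "c = (\<lambda>p. if Q (h (fst p)) (h (snd p)) then 0 else 1 :: nat)"
  have c: "c \<in> Field \<kappa> \<times> Field \<kappa> \<rightarrow> {..<2}" by (auto simp: c_def)
  obtain A B i where AB: "A \<subseteq> Field \<kappa>" "B \<subseteq> Field \<kappa>" "|A| =o \<kappa>" "|B| =o natLeq"
    "\<forall>p\<in>A \<times> B. c p = i"
    using assms(1)[unfolded polarized_def, THEN bspec, OF c] by (elim exE conjE) (rule that)
  have img: "|h ` C| =o |C|" if "C \<subseteq> Field \<kappa>" for C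
  proof -
    have "bij_betw h C (h ` C)" using that h by (auto intro: bij_betw_subset)
    then show ?thesis by (rule card_of_ordIsoI[THEN ordIso_symmetric])
  qed
  show thesis
  proof (rule that[of "h ` A" "h ` B"])
    show "h ` A \<subseteq> S" "h ` B \<subseteq> S" using h AB by (auto simp: bij_betw_def)
    show "|h ` A| =o \<kappa>" "|h ` B| =o natLeq"
      using img AB ordIso_transitive by blast+
    show "(\<forall>x\<in>h ` A. \<forall>y\<in>h ` B. Q x y) \<or> (\<forall>x\<in>h ` A. \<forall>y\<in>h ` B. \<not> Q x y)"
    proof (cases "i = 0")
      case True
      then show ?thesis using AB(5) by (fastforce simp: c_def split: if_splits)
    next
      case False
      then show ?thesis using AB(5) by (fastforce simp: c_def split: if_splits)
    qed
  qed
qed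

section \<open>Levels in a graph with small degrees\<close>

text \<open>
  Each vertex \<open>x\<close> enters \<open>E n\<close> as soon as \<open>P n\<close> bounds its degree, so that the neighbourhood of
  \<open>E n\<close> is small; the levels are differences of sufficiently fast growing sets \<open>E n\<close>.
\<close>

lemma small_degrees_levels:
  fixes D :: "'a \<Rightarrow> 'a \<Rightarrow> bool" and P :: "nat \<Rightarrow> 'a set"
  assumes inf: "infinite K" and X: "|\<Union>n. P n| =o |K|" and inc: "mono P"
    and small: "\<And>n. |P n| <o |K|"
    and deg: "\<And>y. y \<in> (\<Union>n. P n) \<Longrightarrow> |{x \<in> (\<Union>n. P n). D x y}| <o |K|"
    and sym: "\<And>x y. D x y \<Longrightarrow> D y x"
  obtains L :: "nat \<Rightarrow> 'a set" where "\<And>n. L n \<subseteq> (\<Union>n. P n)" "\<And>n. |L n| <o |K|"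
    "|\<Union>n. L n| =o |K|" "\<And>m n. m \<noteq> n \<Longrightarrow> L m \<inter> L n = {}"
    "\<And>m n x y. \<lbrakk>m \<noteq> n; x \<in> L m; y \<in> L n\<rbrakk> \<Longrightarrow> \<not> D x y"
proof -
  define X where "X = (\<Union>n. P n)"
  have XK: "|X| =o |K|" and infX: "infinite X"
    using assms(1,2) card_of_ordIso_finite by (auto simp: X_def)
  have less: "|A| <o |X|" if "|A| <o |K|" for A :: "'a set"
    using that XK ordIso_symmetric ordLess_ordIso_trans by blast
  define N where "N = (\<lambda>y. {x \<in> X. D x y})"
  have N: "|N y| <o |K|" if "y \<in> X" for y using deg that by (simp add: N_def X_def)
  \<comment> \<open>A union of few small sets can be full when the cardinal is singular. The uniform
    bound \<open>|P n|\<close> on the degrees excludes this for the neighbourhoods of the points of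
    \<open>E n\<close>.\<close>
  define E where "E = (\<lambda>n. {x \<in> P n. |N x| \<le>o |P n| })"
  have incE: "mono E"
    unfolding mono_iff_le_Suc
  proof (intro allI subsetI)
    fix n x assume "x \<in> E n"
    moreover have "P n \<subseteq> P (Suc n)" using inc by (simp add: mono_iff_le_Suc)
    ultimately show "x \<in> E (Suc n)"
      unfolding E_def by (auto intro: ordLeq_transitive card_of_mono1)
  qed
  have UE: "(\<Union>n. E n) = X"
  proof
    show "(\<Union>n. E n) \<subseteq> X" by (auto simp: E_def X_def)
    show "X \<subseteq> (\<Union>n. E n)"
    proof
      fix x assume x: "x \<in> X"
      then obtain m where m: "x \<in> P m" by (auto simp: X_def)
      \<comment> \<open>The sizes of the \<open>P n\<close> exceed every size below
        \<open>|K|\<close>, in particular the degree of \<open>x\<close>; the later of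
        \<open>m\<close> and \<open>n\<close> also keeps \<open>x\<close> inside.\<close>
      obtain n where n: "|N x| <o |P n|"
        using chain_card_unbounded[OF inc] N[OF x] less infX by (metis X_def)
      have "P m \<subseteq> P (max m n)" "P n \<subseteq> P (max m n)" using inc by (auto simp: mono_def)
      then have "x \<in> E (max m n)" using m n unfolding E_def
        by (auto intro: ordLeq_transitive card_of_mono1 ordLess_imp_ordLeq)
      then show "x \<in> (\<Union>n. E n)" by blast
    qed
  qed
  define F where "F = (\<lambda>n. E n \<union> (\<Union>x\<in>E n. N x))"
  have EK: "|E n| <o |K|" for n
  proof -
    have "|E n| \<le>o |P n|" by (rule card_of_mono1) (auto simp: E_def)
    then show ?thesis using small ordLeq_ordLess_trans by blast
  qed
  have FK: "|F n| <o |K|" for n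
  proof -
    have "|\<Union>x\<in>E n. N x| <o |K|"
    proof (cases "finite (P n)")
      case True
      have "finite (N x)" if "x \<in> E n" for x
        using that True card_of_ordLeq_finite by (auto simp: E_def)
      moreover have "finite (E n)" using True by (auto simp: E_def)
      ultimately have "finite (\<Union>x\<in>E n. N x)" by blast
      then show ?thesis using inf by (rule finite_card_less_infinite)
    next
      case False
      have "|E n| \<le>o |P n|" by (rule card_of_mono1) (auto simp: E_def)
      then have "|\<Union>x\<in>E n. N x| \<le>o |P n|"
        using False by (intro card_of_UNION_ordLeq_infinite) (auto simp: E_def)
      then show ?thesis using small ordLeq_ordLess_trans by blast
    qed
    then show ?thesis unfolding F_def using EK inf card_of_Un_ordLess_infinite by blast
  qed
  have incF: "mono F" using incE unfolding F_def mono_def by blast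
  \<comment> \<open>Twice the size of \<open>F n\<close> is exceeded, so that removing
    \<open>F n\<close> from \<open>E m\<close> leaves more than \<open>|F n|\<close> points, for
    finite and infinite sizes alike.\<close>
  have "\<exists>m>n. |F n <+> F n| <o |E m|" for n
  proof -
    have "|F n <+> F n| <o |K|" using FK inf card_of_Plus_ordLess_infinite by blast
    then have "|F n <+> F n| <o |X|" using XK ordIso_symmetric ordLess_ordIso_trans by blast
    then obtain m where "|F n <+> F n| <o |E m|"
      using chain_card_unbounded[OF incE] infX UE by metis
    moreover have "|E m| \<le>o |E (max m (Suc n))|"
      using incE by (intro card_of_mono1) (auto simp: mono_def)
    ultimately have "|F n <+> F n| <o |E (max m (Suc n))|" using ordLess_ordLeq_trans by blast
    then show ?thesis by (intro exI[of _ "max m (Suc n)"]) auto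
  qed
  then obtain s where s: "\<And>n. s n > n" "\<And>n. |F n <+> F n| <o |E (s n)|" by metis
  define r where "r = (\<lambda>k. (s ^^ k) 0)"
  have rS: "r (Suc k) = s (r k)" for k by (simp add: r_def)
  have "strict_mono r" by (simp add: strict_mono_Suc_iff rS s)
  then have rmono: "r m \<le> r n" if "m \<le> n" for m n using that by (simp add: strict_mono_less_eq)
  have rge: "n \<le> r n" for n using \<open>strict_mono r\<close> by (rule strict_mono_imp_increasing)
  define L where "L = (\<lambda>k. E (r (Suc k)) - F (r k))"
  have LX: "L n \<subseteq> X" for n using UE by (auto simp: L_def)
  have LE: "x \<in> E (r n)" if "x \<in> L m" "m < n" for x m n
  proof -
    have "E (r (Suc m)) \<subseteq> E (r n)" using incE rmono[of "Suc m" n] that by (simp add: mono_def)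
    then show ?thesis using that by (auto simp: L_def)
  qed
  have big: "|F (r k)| <o |L k|" for k
  proof (rule ccontr)
    assume "\<not> ?thesis"
    then have "|L k| \<le>o |F (r k)|" by (meson card_of_Well_order not_ordLess_iff_ordLeq)
    then have "|L k <+> F (r k)| \<le>o |F (r k) <+> F (r k)|" by (rule card_of_Plus_mono1)
    moreover have "|L k \<union> F (r k)| \<le>o |L k <+> F (r k)|" by (rule card_of_Un_Plus_ordLeq)
    moreover have "|E (r (Suc k))| \<le>o |L k \<union> F (r k)|"
      by (rule card_of_mono1) (auto simp: L_def)
    ultimately have "|E (r (Suc k))| \<le>o |F (r k) <+> F (r k)|" by (meson ordLeq_transitive)
    then show False using s(2)[of "r k"] by (simp add: rS not_ordLess_ordLeq)
  qed
  \<comment> \<open>A union of levels smaller than \<open>X\<close> would be smaller than some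
    \<open>E n\<close>. But \<open>E n\<close> lies in \<open>F (r n)\<close>, and
    \<open>L n\<close> is larger than that.\<close>
  have full: "|\<Union>n. L n| =o |K|"
  proof -
    have "|\<Union>n. L n| =o |X|"
    proof (rule ccontr)
      assume "\<not> ?thesis"
      then have "|\<Union>n. L n| <o |X|" using LX by (intro subset_small_or_full) auto
      then obtain n where "|\<Union>n. L n| <o |E n|"
        using chain_card_unbounded[OF incE] infX UE by metis
      moreover have "|E n| \<le>o |F (r n)|"
        using incE rge[of n] by (intro card_of_mono1) (auto simp: F_def mono_def)
      moreover have "|L n| \<le>o |\<Union>n. L n|" by (rule card_of_mono1) auto
      ultimately have "|L n| <o |L n|"
        using big by (meson ordLeq_ordLess_trans ordLess_ordLeq_trans ordLess_transitive)
      then show False by (simp add: ordLess_irreflexive)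
    qed
    then show ?thesis using XK ordIso_transitive by blast
  qed
  \<comment> \<open>The earlier level lies in \<open>E (r n)\<close>, and the later one avoids
    \<open>F (r n)\<close>, which contains \<open>E (r n)\<close> together with its neighbours in
    \<open>X\<close>.\<close>
  have indep: "L m \<inter> L n = {} \<and> (\<forall>x\<in>L m. \<forall>y\<in>L n. \<not> D x y)" if "m < n" for m n
  proof (intro conjI ballI)
    show "L m \<inter> L n = {}" using LE[OF _ that] by (auto simp: L_def F_def)
    fix x y assume x: "x \<in> L m" and y: "y \<in> L n"
    then have "x \<in> E (r n)" using LE that by blast
    moreover have "y \<in> X" "y \<notin> F (r n)" using y LX by (auto simp: L_def)
    ultimately show "\<not> D x y" using sym by (auto simp: F_def N_def)
  qed
  show thesis
  proof (rule that[of L])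
    show "L n \<subseteq> (\<Union>n. P n)" for n using LX by (simp add: X_def)
    show "|L n| <o |K|" for n
      using EK[of "r (Suc n)"] card_of_mono1[of "L n" "E (r (Suc n))"]
      by (auto simp: L_def intro: ordLeq_ordLess_trans)
    show "|\<Union>n. L n| =o |K|" by (rule full)
    show "L m \<inter> L n = {}" if "m \<noteq> n" for m n
      using that indep by (metis Int_commute linorder_neqE_nat)
    show "\<not> D x y" if "m \<noteq> n" "x \<in> L m" "y \<in> L n" for m n x y
      using that indep sym by (metis linorder_neqE_nat)
  qed
qed

section \<open>Separating two sets by levels\<close>

lemma infinite_nat_split:
  assumes "infinite (S :: nat set)"
  obtains S1 S2 where "S1 \<subseteq> S" "S2 \<subseteq> S" "S1 \<inter> S2 = {}" "infinite S1" "infinite S2"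
proof
  let ?e = "enumerate S"
  have inj: "inj ?e" using assms strict_mono_enumerate strict_mono_imp_inj_on by blast
  show "range (\<lambda>i. ?e (2 * i)) \<subseteq> S" "range (\<lambda>i. ?e (2 * i + 1)) \<subseteq> S"
    using assms enumerate_in_set by auto
  have "2 * i \<noteq> 2 * j + 1" for i j :: nat by presburger
  then show "range (\<lambda>i. ?e (2 * i)) \<inter> range (\<lambda>i. ?e (2 * i + 1)) = {}"
    using inj by (auto dest: injD)
  show "infinite (range (\<lambda>i. ?e (2 * i)))" "infinite (range (\<lambda>i. ?e (2 * i + 1)))"
    using inj by (auto intro!: range_inj_infinite injI dest!: injD[OF inj])
qed

text \<open>Removing from \<open>A\<close> every level that meets \<open>B\<close> could leave too
  little. If \<open>B\<close> meets finitely many levels, an infinite part of it lies in one level,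
  whose removal from \<open>A\<close> is harmless. Otherwise the levels met contain two disjoint
  infinite sets; since each point of \<open>A\<close> avoids at least one of them, a full part of
  \<open>A\<close> avoids the same one, and \<open>B\<close> is restricted to that one.\<close>

lemma split_by_levels:
  fixes lev :: "'a \<Rightarrow> nat"
  assumes inf: "infinite K" and A: "A \<subseteq> K" "|A| =o |K|" and B: "infinite B"
    and small: "\<And>n. |{x \<in> A. lev x = n}| <o |K|"
  obtains A' B' where "A' \<subseteq> A" "B' \<subseteq> B" "|A'| =o |K|" "infinite B'"
    "\<And>x y. \<lbrakk>x \<in> A'; y \<in> B'\<rbrakk> \<Longrightarrow> lev x \<noteq> lev y"
proof (cases "finite (lev ` B)")
  case True
  then obtain m where m: "infinite {y \<in> B. lev y = m}"
    using B pigeonhole_infinite[of B lev] by (auto simp: conj_commute)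
  show thesis
  proof (rule that[of "A - {x \<in> A. lev x = m}" "{y \<in> B. lev y = m}"])
    show "|A - {x \<in> A. lev x = m}| =o |K|" using card_of_Diff_full[OF inf A small] .
  qed (use m in auto)
next
  case False
  then obtain S1 S2 where S: "S1 \<subseteq> lev ` B" "S2 \<subseteq> lev ` B" "S1 \<inter> S2 = {}"
    "infinite S1" "infinite S2"
    by (rule infinite_nat_split)
  have fib: "infinite {y \<in> B. lev y \<in> T}" if "T \<subseteq> lev ` B" "infinite T" for T
  proof -
    have "T \<subseteq> lev ` {y \<in> B. lev y \<in> T}" using that by blast
    then show ?thesis using that(2) finite_surj by blast
  qed
  have "A = {x \<in> A. lev x \<notin> S1} \<union> {x \<in> A. lev x \<notin> S2}" using S(3) by blast
  then consider "|{x \<in> A. lev x \<notin> S1}| =o |K|" | "|{x \<in> A. lev x \<notin> S2}| =o |K|"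
    using card_of_Un_full[OF inf A] by blast
  then show thesis
  proof cases
    case 1
    show thesis
      by (rule that[of "{x \<in> A. lev x \<notin> S1}" "{y \<in> B. lev y \<in> S1}"]) (use 1 S fib in auto)
  next
    case 2
    show thesis
      by (rule that[of "{x \<in> A. lev x \<notin> S2}" "{y \<in> B. lev y \<in> S2}"]) (use 2 S fib in auto)
  qed
qed

section \<open>Infinite cliques from full neighbourhoods\<close>

lemma infinite_clique_if_hereditary:
  fixes D :: "'a \<Rightarrow> 'a \<Rightarrow> bool"
  assumes inf: "infinite K" and sym: "\<And>x y. D x y \<Longrightarrow> D y x"
    and step: "\<And>A. \<lbrakk>A \<subseteq> K; |A| =o |K|\<rbrakk> \<Longrightarrow> \<exists>y\<in>A. |{x \<in> A. D x y}| =o |K|"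
  shows "\<exists>A. infinite A \<and> A \<subseteq> K \<and> (\<forall>x\<in>A. \<forall>y\<in>A. x \<noteq> y \<longrightarrow> D x y)"
proof -
  \<comment> \<open>A pair consists of a chosen vertex and a full reservoir of its neighbours, from
    which all later vertices are taken.\<close>
  define OK where "OK = (\<lambda>p. snd p \<subseteq> K \<and> |snd p| =o |K| \<and> fst p \<in> K \<and>
    (\<forall>x\<in>snd p. x \<noteq> fst p \<and> D x (fst p)))"
  have ex: "\<exists>p. OK p \<and> snd p \<subseteq> A \<and> fst p \<in> A" if A: "A \<subseteq> K" "|A| =o |K|" for A
  proof -
    obtain y where y: "y \<in> A" "|{x \<in> A. D x y}| =o |K|" using step[OF A] by blast
    \<comment> \<open>\<open>D y y\<close> may hold, so \<open>y\<close> has to be removed from its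
      own neighbourhood to keep the chosen vertices distinct.\<close>
    have "|{y}| <o |K|" using inf by (simp add: finite_card_less_infinite)
    then have "|{x \<in> A. D x y} - {y}| =o |K|"
      using inf A y by (intro card_of_Diff_full) auto
    then show ?thesis
      using A y by (intro exI[of _ "(y, {x \<in> A. D x y} - {y})"]) (auto simp: OK_def)
  qed
  have "\<exists>p. \<forall>n. OK (p n) \<and> (snd (p (Suc n)) \<subseteq> snd (p n) \<and> fst (p (Suc n)) \<in> snd (p n))"
  proof (rule dependent_nat_choice)
    show "\<exists>p. OK p" using ex[OF subset_refl card_of_refl] by blast
    show "\<exists>q. OK q \<and> snd q \<subseteq> snd p \<and> fst q \<in> snd p" if "OK p" for p
      using that ex[of "snd p"] by (simp add: OK_def)
  qed
  then obtain p where p: "\<And>n. OK (p n)" "\<And>n. snd (p (Suc n)) \<subseteq> snd (p n)"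
    "\<And>n. fst (p (Suc n)) \<in> snd (p n)" by blast
  have dec: "snd (p n) \<subseteq> snd (p m)" if "m \<le> n" for m n
    using lift_Suc_antimono_le[of "\<lambda>n. snd (p n)"] p(2) that by blast
  have later: "fst (p n) \<in> snd (p m)" if "m < n" for m n
    using p(3) dec that by (metis less_Suc_eq_le less_imp_Suc_add subsetD le_add1)
  have ne: "fst (p n) \<noteq> fst (p m) \<and> D (fst (p n)) (fst (p m))" if "m < n" for m n
    using later[OF that] p(1)[of m] by (auto simp: OK_def)
  have "inj (\<lambda>n. fst (p n))" by (rule linorder_injI) (use ne in metis)
  then have "infinite (range (\<lambda>n. fst (p n)))" by (rule range_inj_infinite)
  moreover have "range (\<lambda>n. fst (p n)) \<subseteq> K" using p(1) by (auto simp: OK_def)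
  moreover have "D (fst (p m)) (fst (p n))" if "fst (p m) \<noteq> fst (p n)" for m n
    using ne sym that by (metis linorder_neqE_nat)
  ultimately show ?thesis by blast
qed

section \<open>Infinite free sets\<close>

theorem theorem3p4:
  fixes \<kappa> :: "'a rel" and f :: "'a \<Rightarrow> 'a set"
  assumes "Card_order \<kappa>" and "infinite (Field \<kappa>)"
    and "polarized \<kappa>"
    and "f \<in> Field \<kappa> \<rightarrow> Pow (Field \<kappa>)"
    and "reasonable \<kappa> f"
  shows "\<exists>A. infinite A \<and> free_for \<kappa> f A"
proof -
  define K where "K = Field \<kappa>"
  define D where "D = (\<lambda>x y. x \<notin> f y \<and> y \<notin> f x)"
  have K: "|K| =o \<kappa>" unfolding K_def by (rule card_of_Field_ordIso[OF assms(1)])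
  have inf: "infinite K" using assms(2) by (simp add: K_def)
  have full_iff: "|A| =o \<kappa> \<longleftrightarrow> |A| =o |K|" for A :: "'a set"
    using K ordIso_symmetric ordIso_transitive by blast
  \<comment> \<open>This is C(\<omega>,\<kappa>): the full set \<open>A\<close> would lie in the
    intersection of the sets \<open>f y\<close> over \<open>B\<close>.\<close>
  have no_rectangle: False
    if A: "|A| =o |K|" and B: "B \<subseteq> K" "|B| =o natLeq" and AB: "\<And>x y. x \<in> A \<Longrightarrow> y \<in> B \<Longrightarrow> x \<in> f y"
    for A B
  proof -
    have "|\<Inter>y\<in>B. f y| <o \<kappa>"
      using assms(5) B unfolding reasonable_def is_C_def K_def by blast
    moreover have "|A| \<le>o |\<Inter>y\<in>B. f y|" by (rule card_of_mono1) (use AB in auto)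
    ultimately show False
      using A full_iff by (meson not_ordLess_ordIso ordLeq_ordLess_trans)
  qed
  \<comment> \<open>Of the two colours, membership \<open>y \<in> f x\<close> is excluded by
    C(\<kappa>,\<omega>), since \<open>B\<close> would lie in the intersection of the sets
    \<open>f x\<close> over \<open>A\<close>.\<close>
  have rectangle: thesis
    if S: "S \<subseteq> K" "|S| =o |K|" and
      th: "\<And>A B. \<lbrakk>A \<subseteq> S; B \<subseteq> S; |A| =o |K|; |B| =o natLeq;
        \<And>x y. x \<in> A \<Longrightarrow> y \<in> B \<Longrightarrow> y \<notin> f x\<rbrakk> \<Longrightarrow> thesis" for S thesis
  proof -
    obtain A B where AB: "A \<subseteq> S" "B \<subseteq> S" "|A| =o \<kappa>" "|B| =o natLeq"
      "(\<forall>x\<in>A. \<forall>y\<in>B. y \<in> f x) \<or> (\<forall>x\<in>A. \<forall>y\<in>B. y \<notin> f x)"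
      using polarized_subset[OF assms(3) _ assms(1), of S "\<lambda>x y. y \<in> f x"] S full_iff by blast
    have "\<not> (\<forall>x\<in>A. \<forall>y\<in>B. y \<in> f x)"
    proof
      assume "\<forall>x\<in>A. \<forall>y\<in>B. y \<in> f x"
      then have "|B| \<le>o |\<Inter>x\<in>A. f x|" by (intro card_of_mono1) auto
      moreover have "|\<Inter>x\<in>A. f x| <o natLeq"
        using assms(5) AB(1,3) S(1) unfolding reasonable_def is_C_def K_def by blast
      ultimately show False using AB(4) by (meson not_ordLess_ordIso ordLeq_ordLess_trans)
    qed
    then show thesis using th AB full_iff by blast
  qed
  have "\<exists>A. infinite A \<and> A \<subseteq> K \<and> (\<forall>x\<in>A. \<forall>y\<in>A. x \<noteq> y \<longrightarrow> D x y)"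
  proof (rule infinite_clique_if_hereditary[OF inf])
    show "D y x" if "D x y" for x y using that by (auto simp: D_def)
    fix S assume S: "S \<subseteq> K" "|S| =o |K|"
    show "\<exists>y\<in>S. |{x \<in> S. D x y}| =o |K|"
    proof (rule ccontr)
      assume "\<not> ?thesis"
      then have deg: "|{x \<in> S. D x y}| <o |K|" if "y \<in> S" for y
        using that S by (intro subset_small_or_full) auto
      obtain A B where AB: "A \<subseteq> S" "B \<subseteq> S" "|A| =o |K|" "|B| =o natLeq"
        and nin: "\<And>x y. x \<in> A \<Longrightarrow> y \<in> B \<Longrightarrow> y \<notin> f x"
        using rectangle[OF S] by blast
      define U where "U = (\<Union>y\<in>B. {x \<in> S. D x y})"
      have US: "U \<subseteq> S" by (auto simp: U_def)
      have Ufull: "|U| =o |K|"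
      proof (rule ccontr)
        assume "\<not> ?thesis"
        then have "|U| <o |K|" using US S by (intro subset_small_or_full) auto
        \<comment> \<open>No point of \<open>A - U\<close> is \<open>D\<close>-related to a point of
          \<open>B\<close>; as \<open>y \<notin> f x\<close> holds there, \<open>x \<in> f y\<close>
          remains.\<close>
        then have "|A - U| =o |K|" using inf AB S by (intro card_of_Diff_full) auto
        then show False
          by (rule no_rectangle[OF _ _ AB(4)]) (use AB S nin in \<open>auto simp: U_def D_def\<close>)
      qed
      have "|B| =o |UNIV :: nat set|"
        using AB(4) card_of_nat ordIso_symmetric ordIso_transitive by blast
      then obtain g where g: "bij_betw g (UNIV :: nat set) B"
        using card_of_ordIso ordIso_symmetric by blast
      \<comment> \<open>Enumerating \<open>B\<close> writes \<open>U\<close> as an increasing union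
        of finite unions of neighbourhoods, each of them small.\<close>
      define P where "P = (\<lambda>n. \<Union>i\<le>n. {x \<in> S. D x (g i)})"
      have UP: "(\<Union>n. P n) = U" using g by (auto simp: U_def P_def bij_betw_def)
      have incP: "mono P" unfolding P_def mono_def by fastforce
      have gS: "g i \<in> S" for i using g AB(2) by (auto simp: bij_betw_def)
      have smallP: "|P n| <o |K|" for n
      proof (induction n)
        case 0
        then show ?case using deg[OF gS, of 0] by (simp add: P_def)
      next
        case (Suc n)
        have "P (Suc n) = P n \<union> {x \<in> S. D x (g (Suc n))}" by (auto simp: P_def atMost_Suc)
        then show ?case using Suc deg[OF gS] inf by (simp add: card_of_Un_ordLess_infinite)
      qed
      have degU: "|{x \<in> U. D x y}| <o |K|" if "y \<in> U" for y
      proof (rule ordLeq_ordLess_trans)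
        show "|{x \<in> U. D x y}| \<le>o |{x \<in> S. D x y}|" using US by (intro card_of_mono1) auto
        show "|{x \<in> S. D x y}| <o |K|" using deg that US by blast
      qed
      obtain L where L: "\<And>n :: nat. L n \<subseteq> U" "\<And>n. |L n| <o |K|" "|\<Union>n. L n| =o |K|"
        "\<And>m n. m \<noteq> n \<Longrightarrow> L m \<inter> L n = {}"
        "\<And>m n x y. \<lbrakk>m \<noteq> n; x \<in> L m; y \<in> L n\<rbrakk> \<Longrightarrow> \<not> D x y"
        by (rule small_degrees_levels[OF inf _ incP smallP, of D])
          (use Ufull degU in \<open>auto simp: UP D_def\<close>)
      define V where "V = (\<Union>n. L n)"
      \<comment> \<open>The value is arbitrary outside \<open>V\<close>; on \<open>V\<close> it is
        the unique level of the point, by disjointness.\<close>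
      define lev where "lev = (\<lambda>x. SOME n. x \<in> L n)"
      have lev: "x \<in> L (lev x)" if "x \<in> V" for x
        using that unfolding V_def lev_def by (auto intro: someI)
      have VK: "V \<subseteq> K" using L(1) US S by (auto simp: V_def)
      obtain A B where AB: "A \<subseteq> V" "B \<subseteq> V" "|A| =o |K|" "|B| =o natLeq"
        and nin: "\<And>x y. x \<in> A \<Longrightarrow> y \<in> B \<Longrightarrow> y \<notin> f x"
        using rectangle[OF VK] L(3) V_def by blast
      have "infinite B" using AB(4) infinite_iff_natLeq_ordLeq ordIso_iff_ordLeq by blast
      moreover have "|{x \<in> A. lev x = n}| <o |K|" for n
      proof (rule ordLeq_ordLess_trans[OF _ L(2)])
        show "|{x \<in> A. lev x = n}| \<le>o |L n|" using lev AB(1) by (intro card_of_mono1) auto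
      qed
      moreover have "A \<subseteq> K" using AB VK by blast
      ultimately obtain A' B' where AB': "A' \<subseteq> A" "B' \<subseteq> B" "|A'| =o |K|" "infinite B'"
        "\<And>x y. \<lbrakk>x \<in> A'; y \<in> B'\<rbrakk> \<Longrightarrow> lev x \<noteq> lev y"
        using split_by_levels[OF inf _ AB(3), of B lev] by blast
      show False
      proof (rule no_rectangle[OF AB'(3)])
        show "B' \<subseteq> K" using AB' AB VK by blast
        show "|B'| =o natLeq" using infinite_subset_natLeq AB AB' by blast
        show "x \<in> f y" if "x \<in> A'" "y \<in> B'" for x y
        proof -
          \<comment> \<open>Points of different levels are not \<open>D\<close>-related, so
            \<open>y \<notin> f x\<close> forces \<open>x \<in> f y\<close>.\<close>
          have "\<not> D x y" using L(5)[OF AB'(5)[OF that]] lev that AB AB' by blast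
          then show ?thesis using nin that AB' by (auto simp: D_def)
        qed
      qed
    qed
  qed
  then show ?thesis by (auto simp: free_for_def D_def K_def)
qed

end
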